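(* Let $s\ge 2$ be an integer and $A_s=\{e_0,\dots,e_{s-1}\}$ with $0<e_0<e_1<\dots<e_{s-1}$. The set $E$ of values of all infinite $A_s$-continued fractions is the interval $[d_0,d_1]$ if and only if $e_i-e_{i-1}\le d_1-d_0$ for all $i\in\{1,2,\dots,s-1\}$. Moreover, in this case $e_0e_{s-1}\le\dfrac{(s-1)^2}{s}$.
   Context: For a sequence $(a_n)_{n\ge1}$ with $a_n\in A_s$, $[0;a_1,a_2,\dots]$ denotes the value of the infinite continued fraction $\cfrac{1}{a_1+\cfrac{1}{a_2+\cdots}}$, i.e. the limit of its convergents, which exists for all such sequences. $E=\{[0;a_1,a_2,\dots]: a_n\in A_s\text{ for all } n\}$. Put $p=e_0e_{s-1}$, $d_0=\min E=\dfrac{\sqrt{p(p+4)}-p}{2e_{s-1}}$ and $d_1=\max E=\dfrac{\sqrt{p(p+4)}-p}{2e_0}$. *)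

theory Defs
  imports Complex_Main
begin

text \<open>
  Sequences of partial quotients are indexed from 0, so \<open>a n\<close> plays the role of \<open>a\<^sub>n\<^sub>+\<^sub>1\<close> and
  \<open>cf_conv a n\<close> is the finite continued fraction $[0; a_1, \dots, a_n]$.
\<close>

fun cf_conv :: "(nat \<Rightarrow> real) \<Rightarrow> nat \<Rightarrow> real" where
  "cf_conv a 0 = 0"
| "cf_conv a (Suc n) = 1 / (a 0 + cf_conv (\<lambda>k. a (Suc k)) n)"

definition cf_value :: "(nat \<Rightarrow> real) \<Rightarrow> real" where
  "cf_value a = lim (cf_conv a)"

definition cf_set :: "real set \<Rightarrow> real set" where
  "cf_set A = {cf_value a | a. \<forall>n. a n \<in> A}"

text \<open>
  The closed forms of $\min E$ and $\max E$ in terms of the least element \<open>m\<close> and the greatest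
  element \<open>M\<close> of the alphabet; lemmas \<open>cf_min_least\<close> and \<open>cf_max_greatest\<close> below
  confirm that they are the minimum and the maximum.
\<close>

definition cf_min :: "real \<Rightarrow> real \<Rightarrow> real" where
  "cf_min m M = (sqrt (m * M * (m * M + 4)) - m * M) / (2 * M)"

definition cf_max :: "real \<Rightarrow> real \<Rightarrow> real" where
  "cf_max m M = (sqrt (m * M * (m * M + 4)) - m * M) / (2 * m)"

text \<open>\<open>cf_tail a n x\<close> is $[0; a_1, \dots, a_{n-1}, a_n + x]$ for $n \ge 1$.\<close>

fun cf_tail :: "(nat \<Rightarrow> real) \<Rightarrow> nat \<Rightarrow> real \<Rightarrow> real" where
  "cf_tail a 0 x = x"
| "cf_tail a (Suc n) x = 1 / (a 0 + cf_tail (\<lambda>k. a (Suc k)) n x)"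

lemma cf_conv_add: "cf_conv a (n + k) = cf_tail a n (cf_conv (\<lambda>i. a (i + n)) k)"
  by (induction n arbitrary: a) auto

lemma cf_conv_eq_tail: "cf_conv a n = cf_tail a n 0"
  using cf_conv_add[of a n 0] by simp

lemma cf_tail_nonneg:
  assumes "\<And>n. a n \<ge> m" "m > 0" "x \<ge> 0"
  shows "cf_tail a n x \<ge> 0"
  using assms
proof (induction n arbitrary: a)
  case (Suc n)
  from Suc.IH[of "\<lambda>k. a (Suc k)"] Suc.prems have "cf_tail (\<lambda>k. a (Suc k)) n x \<ge> 0" by simp
  moreover have "a 0 > 0" using Suc.prems(1)[of 0] Suc.prems(2) by linarith
  ultimately show ?case by simp
qed simp

lemma cf_conv_bounds:
  assumes "\<And>n. a n \<ge> m" "m > 0"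
  shows "cf_conv a n \<in> {0..1 / m}"
proof (cases n)
  case (Suc k)
  have "cf_conv (\<lambda>k. a (Suc k)) k \<ge> 0"
    unfolding cf_conv_eq_tail by (rule cf_tail_nonneg[where m = m]) (use assms in auto)
  moreover have "a 0 \<ge> m" using assms by simp
  ultimately show ?thesis using assms(2) Suc by (auto simp: divide_simps)
qed (use assms in auto)

lemma cf_step_contract:
  fixes a b u v m :: real
  assumes "a \<ge> m" "b \<ge> m" "m > 0" "u \<ge> 0" "v \<ge> 0"
  shows "\<bar>1 / (a + 1 / (b + u)) - 1 / (a + 1 / (b + v))\<bar> \<le> 1 / (1 + m^2) * \<bar>u - v\<bar>"
proof -
  have pos: "a > 0" "b > 0" using assms by auto
  have m2: "m^2 \<le> a * b"
    unfolding power2_eq_square using assms by (intro mult_mono) auto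
  let ?U = "1 + a * b + a * u" and ?V = "1 + a * b + a * v"
  have "a * u \<ge> 0" "a * v \<ge> 0" using pos assms by simp_all
  then have UV: "?U \<ge> 1 + m^2" "?V \<ge> 1" using m2 zero_le_power2[of m] by linarith+
  have m1: "1 + m^2 > 0" by (simp add: add_pos_nonneg)
  have "?U * ?V \<ge> (1 + m^2) * 1" using UV m1 by (intro mult_mono) auto
  then have le: "1 / (?U * ?V) \<le> 1 / (1 + m^2)" using m1 by (intro divide_left_mono) auto
  have conv: "1 / (a + 1 / (b + w)) = (b + w) / (1 + a * b + a * w)" if "w \<ge> 0" for w
  proof -
    have "b + w > 0" "1 + a * b + a * w > 0" using that pos by (auto simp: add_pos_nonneg)
    moreover from this have "a + 1 / (b + w) = (1 + a * b + a * w) / (b + w)"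
      by (simp add: field_simps)
    ultimately show ?thesis by simp
  qed
  have nz: "?U \<noteq> 0" "?V \<noteq> 0" "?U > 0" "?V > 0" using UV m1 by linarith+
  have "1 / (a + 1 / (b + u)) - 1 / (a + 1 / (b + v)) = (1 / (?U * ?V)) * (u - v)"
    unfolding conv[OF assms(4)] conv[OF assms(5)]
    by (subst diff_frac_eq[OF nz(1,2)]) (simp add: algebra_simps)
  then have "\<bar>1 / (a + 1 / (b + u)) - 1 / (a + 1 / (b + v))\<bar> = (1 / (?U * ?V)) * \<bar>u - v\<bar>"
    using nz by (simp add: abs_mult)
  also have "\<dots> \<le> 1 / (1 + m^2) * \<bar>u - v\<bar>" by (rule mult_right_mono[OF le]) simp
  finally show ?thesis .
qed

lemma cf_tail_contract:
  assumes "\<And>n. a n \<ge> m" "m > 0" "x \<ge> 0" "y \<ge> 0"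
  shows "\<bar>cf_tail a n x - cf_tail a n y\<bar>
    \<le> (1 + 1 / m^2) * \<bar>x - y\<bar> * (1 / (1 + m^2)) ^ (n div 2)"
  using assms(1)
proof (induction n arbitrary: a rule: induct_nat_012)
  case 0
  show ?case by (simp add: mult_le_cancel_right1)
next
  case 1
  have a: "a 0 > 0" "a 0 \<ge> m" using 1[of 0] assms by auto
  have "1 / (a 0 + x) - 1 / (a 0 + y) = (y - x) / ((a 0 + x) * (a 0 + y))"
    using a assms by (subst diff_frac_eq) auto
  then have "\<bar>1 / (a 0 + x) - 1 / (a 0 + y)\<bar> = \<bar>x - y\<bar> / ((a 0 + x) * (a 0 + y))"
    using a assms by (simp add: abs_mult abs_minus_commute)
  also have "\<dots> \<le> \<bar>x - y\<bar> / m^2"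
    unfolding power2_eq_square using a assms by (intro divide_left_mono mult_mono mult_pos_pos) auto
  also have "\<dots> \<le> (1 + 1 / m^2) * \<bar>x - y\<bar>" by (simp add: algebra_simps)
  finally show ?case by simp
next
  case (ge2 n)
  let ?a = "\<lambda>k. a (Suc (Suc k))"
  let ?q = "1 / (1 + m^2)"
  have "\<bar>cf_tail a (Suc (Suc n)) x - cf_tail a (Suc (Suc n)) y\<bar>
      \<le> ?q * \<bar>cf_tail ?a n x - cf_tail ?a n y\<bar>"
    unfolding cf_tail.simps
    by (rule cf_step_contract) (use assms ge2.prems in \<open>auto intro!: cf_tail_nonneg[where m = m]\<close>)
  also have "\<dots> \<le> ?q * ((1 + 1 / m^2) * \<bar>x - y\<bar> * ?q ^ (n div 2))"
    by (rule mult_left_mono[OF ge2.IH(1)]) (use ge2.prems in auto)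
  finally show ?case by simp
qed

lemma cf_rate_tendsto_0:
  assumes "(m :: real) > 0"
  shows "(\<lambda>n. K * (1 / (1 + m^2)) ^ (n div 2)) \<longlonglongrightarrow> 0"
proof -
  have "(\<lambda>n. (1 / (1 + m^2)) ^ n) \<longlonglongrightarrow> 0"
    using assms by (intro LIMSEQ_realpow_zero) (auto simp: add_pos_nonneg)
  moreover have "filterlim (\<lambda>n::nat. n div 2) at_top at_top"
    unfolding filterlim_at_top
  proof
    fix Z :: nat
    show "eventually (\<lambda>n. Z \<le> n div 2) at_top"
      by (rule eventually_sequentiallyI[of "2 * Z"]) linarith
  qed
  ultimately have "(\<lambda>n. (1 / (1 + m^2)) ^ (n div 2)) \<longlonglongrightarrow> 0"
    by (rule filterlim_compose)
  from tendsto_mult_left[OF this, of K] show ?thesis by simp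
qed

lemma cf_conv_convergent:
  assumes "\<And>n. a n \<ge> m" "m > 0"
  shows "convergent (cf_conv a)"
proof -
  let ?r = "\<lambda>n. (1 + 1 / m^2) * (1 / m) * (1 / (1 + m^2)) ^ (n div 2)"
  have *: "\<bar>cf_conv a (n + k) - cf_conv a n\<bar> \<le> ?r n" for n k
  proof -
    let ?x = "cf_conv (\<lambda>i. a (i + n)) k"
    have x: "?x \<in> {0..1 / m}" by (rule cf_conv_bounds) (use assms in auto)
    have "\<bar>cf_conv a (n + k) - cf_conv a n\<bar>
        \<le> (1 + 1 / m^2) * \<bar>?x - 0\<bar> * (1 / (1 + m^2)) ^ (n div 2)"
      unfolding cf_conv_add cf_conv_eq_tail[of a n]
      by (rule cf_tail_contract) (use assms x in auto)
    also have "\<dots> \<le> ?r n"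
      by (intro mult_right_mono mult_left_mono) (use x in \<open>auto simp: add_nonneg_nonneg\<close>)
    finally show ?thesis .
  qed
  have "Cauchy (cf_conv a)"
  proof (rule CauchyI)
    fix \<epsilon> :: real assume "\<epsilon> > 0"
    then have "\<epsilon> / 2 > 0" by simp
    from order_tendstoD(2)[OF cf_rate_tendsto_0[OF assms(2)] this]
    have "\<exists>N. ?r N < \<epsilon> / 2" by (rule eventually_happens'[OF sequentially_bot])
    then obtain N where "?r N < \<epsilon> / 2" ..
    then have N: "\<bar>cf_conv a (N + k) - cf_conv a N\<bar> < \<epsilon> / 2" for k
      using *[of N k] by linarith
    have "norm (cf_conv a i - cf_conv a j) < \<epsilon>" if "i \<ge> N" "j \<ge> N" for i j
      using N[of "i - N"] N[of "j - N"] that by (simp add: abs_if split: if_splits)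
    then show "\<exists>M. \<forall>i\<ge>M. \<forall>j\<ge>M. norm (cf_conv a i - cf_conv a j) < \<epsilon>" by blast
  qed
  then show ?thesis by (simp add: Cauchy_convergent_iff)
qed

lemma cf_tail_tendsto_value:
  assumes "\<And>n. a n \<ge> m" "m > 0" "x \<ge> 0"
  shows "(\<lambda>n. cf_tail a n x) \<longlonglongrightarrow> cf_value a"
proof -
  have 1: "cf_conv a \<longlonglongrightarrow> cf_value a"
    unfolding cf_value_def using cf_conv_convergent[OF assms(1,2)] by (simp add: convergent_LIMSEQ_iff)
  have "(\<lambda>n. cf_tail a n x - cf_conv a n) \<longlonglongrightarrow> 0"
    by (rule tendsto_0_le[OF cf_rate_tendsto_0[OF assms(2), of "(1 + 1 / m^2) * \<bar>x - 0\<bar>"], of _ 1])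
      (intro always_eventually allI,
       use cf_tail_contract[where a = a and m = m and x = x and y = 0] assms in \<open>auto simp: cf_conv_eq_tail abs_mult add_nonneg_nonneg\<close>)
  from tendsto_add[OF this 1] show ?thesis by simp
qed

lemma cf_min_max_fix:
  assumes "0 < m" "m \<le> M"
  shows "0 < cf_min m M" "cf_min m M = 1 / (M + cf_max m M)"
    "cf_max m M = 1 / (m + cf_min m M)" "cf_min m M \<le> cf_max m M"
proof -
  define p where "p = m * M"
  define r where "r = sqrt (p * (p + 4))"
  have p: "p > 0" using assms by (simp add: p_def)
  have r2: "r * r = p * (p + 4)" unfolding r_def using p by simp
  have rp: "r > p"
    unfolding r_def by (rule real_less_rsqrt) (use p in \<open>simp add: power2_eq_square algebra_simps\<close>)
  have mM: "m > 0" "M > 0" using assms by auto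
  have d0: "cf_min m M = (r - p) / (2 * M)" and d1: "cf_max m M = (r - p) / (2 * m)"
    unfolding cf_min_def cf_max_def r_def p_def by simp_all
  show "0 < cf_min m M" using d0 rp mM by simp
  have rr: "(r - p) * (r + p) = 4 * p" using r2 by (simp add: algebra_simps)
  have e1: "M + cf_max m M = (r + p) / (2 * m)" unfolding d1 using mM by (simp add: field_simps p_def)
  show "cf_min m M = 1 / (M + cf_max m M)"
    unfolding e1 d0 using mM rp p rr by (simp add: divide_simps) (simp add: p_def algebra_simps)
  have e2: "m + cf_min m M = (r + p) / (2 * M)" unfolding d0 using mM by (simp add: field_simps p_def)
  show "cf_max m M = 1 / (m + cf_min m M)"
    unfolding e2 d1 using mM rp p rr by (simp add: divide_simps) (simp add: p_def algebra_simps)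
  show "cf_min m M \<le> cf_max m M"
    unfolding d0 d1 using mM rp assms by (intro divide_left_mono) auto
qed

lemma cf_tail_bounds:
  assumes "\<And>n. a n \<in> {m..M}" "0 < m" "x \<in> {cf_min m M..cf_max m M}"
  shows "cf_tail a n x \<in> {cf_min m M..cf_max m M}"
  using assms(1)
proof (induction n arbitrary: a)
  case (Suc n)
  let ?u = "cf_tail (\<lambda>k. a (Suc k)) n x"
  have u: "?u \<in> {cf_min m M..cf_max m M}" using Suc by simp
  have a: "a 0 \<in> {m..M}" using Suc.prems .
  then have "m \<le> M" by simp
  note fp = cf_min_max_fix[OF assms(2) this]
  have "1 / (M + cf_max m M) \<le> 1 / (a 0 + ?u)" "1 / (a 0 + ?u) \<le> 1 / (m + cf_min m M)"
    using u a assms(2) fp(1,4) by (auto intro!: divide_left_mono mult_pos_pos)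
  then show ?case unfolding fp(2,3)[symmetric] by simp
qed (use assms in auto)

lemma cf_set_bounds:
  assumes "A \<subseteq> {m..M}" "0 < m" "m \<le> M" "x \<in> cf_set A"
  shows "x \<in> {cf_min m M..cf_max m M}"
proof -
  from assms(4) obtain a where a: "\<And>n. a n \<in> A" "x = cf_value a" by (auto simp: cf_set_def)
  have b: "a n \<in> {m..M}" for n using a(1) assms(1) by blast
  note fp = cf_min_max_fix[OF assms(2,3)]
  have "(\<lambda>n. cf_tail a n (cf_min m M)) \<longlonglongrightarrow> x"
    unfolding a(2) by (rule cf_tail_tendsto_value[where m = m]) (use b fp(1,4) assms in auto)
  moreover have "cf_tail a n (cf_min m M) \<in> {cf_min m M..cf_max m M}" for n
    by (rule cf_tail_bounds) (use b fp(1,4) assms in auto)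
  ultimately show ?thesis
    by (meson closed_atLeastAtMost closed_sequentially)
qed

lemma cf_alternating:
  assumes "0 < m" "m \<le> M"
  shows "cf_value (\<lambda>n. if even n then M else m) = cf_min m M"
    and "cf_value (\<lambda>n. if even n then m else M) = cf_max m M"
proof -
  let ?a = "\<lambda>n::nat. if even n then M else m" and ?b = "\<lambda>n::nat. if even n then m else M"
  note fp = cf_min_max_fix[OF assms]
  have sh: "(\<lambda>k. ?a (Suc k)) = ?b" "(\<lambda>k. ?b (Suc k)) = ?a" by auto
  have *: "cf_tail ?a n (if even n then cf_min m M else cf_max m M) = cf_min m M \<and>
        cf_tail ?b n (if even n then cf_max m M else cf_min m M) = cf_max m M" for n
  proof (induction n)
    case (Suc n)
    then show ?case unfolding cf_tail.simps sh by (auto simp: fp(2,3)[symmetric])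
  qed simp
  have **: "cf_tail ?a (2 * n) (cf_min m M) = cf_min m M" "cf_tail ?b (2 * n) (cf_max m M) = cf_max m M" for n
    using *[of "2 * n"] by simp_all
  have ev: "filterlim (\<lambda>n::nat. 2 * n) at_top sequentially"
    by (rule filterlim_subseq) (simp add: strict_mono_def)
  have "(\<lambda>n. cf_tail ?a n (cf_min m M)) \<longlonglongrightarrow> cf_value ?a"
    by (rule cf_tail_tendsto_value[where m = m]) (use fp(1,4) assms in auto)
  from filterlim_compose[OF this ev] have "(\<lambda>n. cf_min m M) \<longlonglongrightarrow> cf_value ?a"
    unfolding ** .
  then show "cf_value ?a = cf_min m M" by (simp add: LIMSEQ_const_iff)
  have "(\<lambda>n. cf_tail ?b n (cf_max m M)) \<longlonglongrightarrow> cf_value ?b"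
    by (rule cf_tail_tendsto_value[where m = m]) (use fp(1,4) assms in auto)
  from filterlim_compose[OF this ev] have "(\<lambda>n. cf_max m M) \<longlonglongrightarrow> cf_value ?b"
    unfolding ** .
  then show "cf_value ?b = cf_max m M" by (simp add: LIMSEQ_const_iff)
qed

lemma
  assumes "A \<subseteq> {m..M}" "m \<in> A" "M \<in> A" "0 < m"
  shows cf_min_least: "cf_min m M \<in> cf_set A" "\<And>x. x \<in> cf_set A \<Longrightarrow> cf_min m M \<le> x"
    and cf_max_greatest: "cf_max m M \<in> cf_set A" "\<And>x. x \<in> cf_set A \<Longrightarrow> x \<le> cf_max m M"
proof -
  have mM: "m \<le> M" using assms by auto
  show "cf_min m M \<in> cf_set A" "cf_max m M \<in> cf_set A"
    unfolding cf_set_def cf_alternating[OF assms(4) mM, symmetric] using assms by fastforce+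
  show "\<And>x. x \<in> cf_set A \<Longrightarrow> cf_min m M \<le> x" "\<And>x. x \<in> cf_set A \<Longrightarrow> x \<le> cf_max m M"
    using cf_set_bounds[OF assms(1,4) mM] by auto
qed

end

theory Submission
  imports Defs
begin

text \<open>
  Write \<open>m\<close>, \<open>M\<close> for the extreme elements of the alphabet \<open>A\<close> and \<open>d\<^sub>0\<close>, \<open>d\<^sub>1\<close> for the extreme
  values. The map $x \mapsto 1/x$ takes $[d_0, d_1]$ onto $[m + d_0, M + d_1]$, and it takes the
  values of continued fractions with first partial quotient $a$ into $a + [d_0, d_1]$. Hence
  \<open>cf_set A\<close> is all of $[d_0, d_1]$ if and only if the translates $a + [d_0, d_1]$, $a \in A$,
  cover $[m + d_0, M + d_1]$ (\<open>cf_set_eq_interval_iff\<close>): given a covering, a suitable first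
  partial quotient can be split off from each point again and again, and the resulting expansion
  converges to the point because the maps \<open>cf_tail a n\<close> contract.
  The translates cover if and only if no two neighbouring ones leave a gap, which is the condition
  $e_i - e_{i-1} \le d_1 - d_0$ (\<open>translates_cover_iff\<close>).

  Summing this condition over $i$ gives $M - m \le (s - 1)(d_1 - d_0)$. Since $d_1 - d_0$ is
  $M - m$ times a function of $p = m M$ only, this is an inequality between $p$ and $s$, and
  solving it for $p$ gives the bound (\<open>cf_diameter_bound\<close>).
\<close>

lemma cf_value_in_cf_set: "(\<And>n. a n \<in> A) \<Longrightarrow> cf_value a \<in> cf_set A"
  unfolding cf_set_def by blast

lemma cf_value_unfold:
  assumes "\<And>n. a n \<ge> m" "m > 0"
  shows "cf_value a = 1 / (a 0 + cf_value (\<lambda>k. a (Suc k)))"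
proof -
  let ?b = "\<lambda>k. a (Suc k)"
  have lim_a: "cf_conv a \<longlonglongrightarrow> cf_value a"
    using cf_tail_tendsto_value[of m a 0] assms by (simp flip: cf_conv_eq_tail)
  have lim_b: "cf_conv ?b \<longlonglongrightarrow> cf_value ?b"
    using cf_tail_tendsto_value[of m ?b 0] assms by (simp flip: cf_conv_eq_tail)
  have "cf_conv ?b n \<ge> 0" for n
    using cf_conv_bounds[of m ?b n] assms by simp
  then have "cf_value ?b \<ge> 0"
    using lim_b by (intro LIMSEQ_le_const) auto
  then have "a 0 + cf_value ?b \<noteq> 0"
    using assms(1)[of 0] assms(2) by linarith
  then have "(\<lambda>n. 1 / (a 0 + cf_conv ?b n)) \<longlonglongrightarrow> 1 / (a 0 + cf_value ?b)"
    by (intro tendsto_intros lim_b)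
  moreover have "(\<lambda>n. 1 / (a 0 + cf_conv ?b n)) \<longlonglongrightarrow> cf_value a"
    using LIMSEQ_Suc[OF lim_a] by simp
  ultimately show ?thesis
    by (rule LIMSEQ_unique[symmetric])
qed

text \<open>
  A formal expansion of \<open>x 0\<close> with remainders \<open>x n\<close> converges to \<open>x 0\<close> when the remainders are
  nonnegative and bounded and the partial quotients are bounded away from 0: replacing the
  remainder \<open>x n\<close> by 0 changes the value of \<open>cf_tail a n\<close> by an amount that tends to 0.
\<close>

lemma cf_value_eqI:
  assumes a: "\<And>n. a n \<ge> m" "m > 0"
    and x: "\<And>n. x n \<in> {0..B}" "\<And>n. x n = 1 / (a n + x (Suc n))"
  shows "cf_value a = x 0"
proof -
  have expand: "cf_tail (\<lambda>i. a (i + k)) n (x (n + k)) = x k" for n k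
  proof (induction n arbitrary: k)
    case (Suc n)
    from Suc[of "Suc k"] show ?case
      by (simp flip: x(2))
  qed simp
  have "(\<lambda>n. x 0 - cf_conv a n) \<longlonglongrightarrow> 0"
  proof (rule tendsto_0_le)
    let ?q = "1 / (1 + m\<^sup>2)"
    show "(\<lambda>n. ((1 + 1 / m\<^sup>2) * B) * ?q ^ (n div 2)) \<longlonglongrightarrow> 0"
      by (rule cf_rate_tendsto_0) fact
    have "norm (x 0 - cf_conv a n) \<le> ((1 + 1 / m\<^sup>2) * B) * ?q ^ (n div 2)" for n
    proof -
      have "norm (x 0 - cf_conv a n) = \<bar>cf_tail a n (x n) - cf_tail a n 0\<bar>"
        using expand[of 0 n] by (simp add: cf_conv_eq_tail)
      also have "\<dots> \<le> (1 + 1 / m\<^sup>2) * \<bar>x n - 0\<bar> * ?q ^ (n div 2)"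
        by (rule cf_tail_contract) (use a x(1)[of n] in auto)
      also have "\<dots> \<le> ((1 + 1 / m\<^sup>2) * B) * ?q ^ (n div 2)"
        using x(1)[of n] by (intro mult_right_mono mult_left_mono) auto
      finally show ?thesis .
    qed
    then show "\<forall>\<^sub>F n in sequentially. norm (x 0 - cf_conv a n)
        \<le> norm (((1 + 1 / m\<^sup>2) * B) * ?q ^ (n div 2)) * 1"
      unfolding mult_1_right real_norm_def
      by (intro always_eventually allI) (rule order_trans[OF _ abs_ge_self])
  qed
  then have "(\<lambda>n. x 0 - (x 0 - cf_conv a n)) \<longlonglongrightarrow> x 0 - 0"
    by (intro tendsto_diff tendsto_const)
  then have "cf_conv a \<longlonglongrightarrow> x 0"
    by simp
  then show ?thesis
    unfolding cf_value_def by (rule limI)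
qed

lemma cf_set_eq_interval_iff:
  assumes "A \<subseteq> {m..M}" "0 < m" "m \<le> M"
  shows "cf_set A = {cf_min m M..cf_max m M} \<longleftrightarrow>
    (\<forall>y\<in>{m + cf_min m M..M + cf_max m M}. \<exists>a\<in>A. y - a \<in> {cf_min m M..cf_max m M})"
    (is "_ \<longleftrightarrow> ?cover")
proof
  let ?d0 = "cf_min m M" and ?d1 = "cf_max m M"
  note fp = cf_min_max_fix[OF assms(2,3)]
  have inverse_ends: "1 / ?d0 = M + ?d1" "1 / ?d1 = m + ?d0"
    using arg_cong[OF fp(2), of inverse] arg_cong[OF fp(3), of inverse]
    by (simp_all only: inverse_eq_divide divide_divide_eq_right mult_1 div_by_1)
  show ?cover if full: "cf_set A = {?d0..?d1}"
  proof
    fix y assume y: "y \<in> {m + ?d0..M + ?d1}"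
    then have "y > 0" using fp(1) assms(2) by simp
    have "1 / (M + ?d1) \<le> 1 / y" "1 / y \<le> 1 / (m + ?d0)"
      using y \<open>y > 0\<close> fp(1) assms(2) by (auto intro!: divide_left_mono mult_pos_pos)
    then have "1 / y \<in> cf_set A"
      unfolding full by (simp flip: fp(2,3))
    then obtain a where a: "\<And>n. a n \<in> A" "1 / y = cf_value a"
      by (auto simp: cf_set_def)
    have "a n \<ge> m" for n using a(1) assms(1) by fastforce
    then have "1 / y = 1 / (a 0 + cf_value (\<lambda>k. a (Suc k)))"
      unfolding a(2) using assms(2) by (rule cf_value_unfold)
    then have "y - a 0 = cf_value (\<lambda>k. a (Suc k))"
      by simp
    then have "y - a 0 \<in> cf_set A"
      using a(1) by (simp add: cf_value_in_cf_set)
    then show "\<exists>a\<in>A. y - a \<in> {?d0..?d1}"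
      using a(1) full by blast
  qed
  show "cf_set A = {?d0..?d1}" if cover: ?cover
  proof
    show "cf_set A \<subseteq> {?d0..?d1}"
      using cf_set_bounds[OF assms] by blast
    show "{?d0..?d1} \<subseteq> cf_set A"
    proof
      fix x assume x: "x \<in> {?d0..?d1}"
      have "\<exists>a\<in>A. 1 / z - a \<in> {?d0..?d1}" if z: "z \<in> {?d0..?d1}" for z
      proof -
        have "1 / ?d1 \<le> 1 / z" "1 / z \<le> 1 / ?d0"
          using z fp(1) by (auto intro!: divide_left_mono mult_pos_pos)
        then show ?thesis
          using cover inverse_ends by simp
      qed
      then obtain g where g: "g z \<in> A" "1 / z - g z \<in> {?d0..?d1}" if "z \<in> {?d0..?d1}" for z
        by metis
      \<comment> \<open>The analogue of the Gauss map: \<open>g z\<close> is the first partial quotient chosen for \<open>z\<close>.\<close>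
      define r where "r n = ((\<lambda>z. 1 / z - g z) ^^ n) x" for n
      have r: "r n \<in> {?d0..?d1}" for n
        by (induction n) (use x g(2) in \<open>auto simp: r_def\<close>)
      have gA: "g (r n) \<in> A" for n
        using g(1) r by blast
      have "cf_value (\<lambda>n. g (r n)) = r 0"
      proof (rule cf_value_eqI)
        show "g (r n) \<ge> m" for n using gA assms(1) by fastforce
        show "r n \<in> {0..?d1}" for n using r[of n] fp(1) by simp
        show "r n = 1 / (g (r n) + r (Suc n))" for n
          by (simp add: r_def)
      qed fact
      then have "x = cf_value (\<lambda>n. g (r n))"
        by (simp add: r_def)
      then show "x \<in> cf_set A"
        using gA by (simp add: cf_value_in_cf_set)
    qed
  qed
qed

lemma translates_cover_iff:
  fixes e :: "nat \<Rightarrow> real"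
  assumes mono: "mono_on {..n} e" and "u \<le> v"
  shows "(\<forall>y\<in>{e 0 + u..e n + v}. \<exists>i\<le>n. y - e i \<in> {u..v}) \<longleftrightarrow>
    (\<forall>i\<in>{1..n}. e i - e (i - 1) \<le> v - u)" (is "?cover \<longleftrightarrow> ?gaps")
proof
  assume cover: ?cover
  show ?gaps
  proof (rule ballI, rule ccontr)
    fix i assume i: "i \<in> {1..n}" and "\<not> e i - e (i - 1) \<le> v - u"
    then have "e (i - 1) + v < e i + u" by simp
    \<comment> \<open>A point of the gap lies to the right of all translates up to \<open>i - 1\<close> and to the left of
      all others.\<close>
    then obtain y where y: "e (i - 1) + v < y" "y < e i + u"
      using dense by blast
    have "e 0 \<le> e (i - 1)" "e i \<le> e n"
      using i by (auto intro!: mono_onD[OF mono])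
    then have "y \<in> {e 0 + u..e n + v}"
      using y \<open>u \<le> v\<close> by simp
    then obtain j where j: "j \<le> n" "y - e j \<in> {u..v}"
      using cover by blast
    have "e j \<le> e (i - 1) \<or> e i \<le> e j"
    proof (cases "j < i")
      case True
      then show ?thesis using i j by (auto intro!: mono_onD[OF mono])
    next
      case False
      then show ?thesis using i j by (auto intro!: mono_onD[OF mono])
    qed
    then show False
      using j(2) y by auto
  qed
next
  assume gaps: ?gaps
  have "\<exists>i\<le>k. y - e i \<in> {u..v}" if "k \<le> n" "y \<in> {e 0 + u..e k + v}" for k y
    using that
  proof (induction k)
    case (Suc k)
    show ?case
    proof (cases "y \<le> e k + v")
      case True
      then show ?thesis using Suc by (auto intro: le_SucI)
    next
      case False
      have "e (Suc k) - e k \<le> v - u"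
        using gaps Suc.prems(1) by (auto dest: bspec[of _ _ "Suc k"])
      then have "y - e (Suc k) \<in> {u..v}"
        using False Suc.prems(2) by auto
      then show ?thesis by blast
    qed
  qed auto
  then show ?cover by blast
qed

lemma cf_diameter_bound:
  assumes "0 < m" "m < M" "t \<ge> 0" and le: "M - m \<le> t * (cf_max m M - cf_min m M)"
  shows "m * M \<le> t\<^sup>2 / (t + 1)"
proof -
  define p where "p = m * M"
  define r where "r = sqrt (p * (p + 4))"
  have "p > 0" using assms by (simp add: p_def)
  then have r2: "r\<^sup>2 = p * (p + 4)" by (simp add: r_def)
  have "cf_max m M - cf_min m M = (M - m) * ((r - p) / (2 * p))"
    unfolding cf_max_def cf_min_def r_def p_def using assms by (simp add: field_simps)
  with le have "(M - m) * 1 \<le> (M - m) * (t * ((r - p) / (2 * p)))"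
    by (simp add: algebra_simps)
  then have "1 \<le> t * ((r - p) / (2 * p))"
    using \<open>m < M\<close> by (simp only: mult_le_cancel_left_pos diff_gt_0_iff_gt)
  then have "p * (t + 2) \<le> t * r"
    using \<open>p > 0\<close> by (simp add: field_simps)
  then have "(p * (t + 2))\<^sup>2 \<le> (t * r)\<^sup>2"
    using \<open>p > 0\<close> \<open>t \<ge> 0\<close> by (intro power_mono) auto
  also have "\<dots> = t\<^sup>2 * (p * (p + 4))"
    by (simp add: power_mult_distrib r2)
  finally have "p * (p * (t + 1)) \<le> p * t\<^sup>2"
    by (simp add: power2_eq_square algebra_simps)
  then have "p * (t + 1) \<le> t\<^sup>2"
    using \<open>p > 0\<close> by simp
  then show ?thesis
    using \<open>t \<ge> 0\<close> by (simp add: p_def pos_le_divide_eq)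
qed

theorem theorem22:
  fixes s :: nat and e :: "nat \<Rightarrow> real" and A E :: "real set" and d\<^sub>0 d\<^sub>1 :: real
  assumes "s \<ge> 2"
    and "e 0 > 0"
    and "strict_mono_on {0..<s} e"
  defines "A \<equiv> e ` {0..<s}"
  defines "E \<equiv> cf_set A"
  defines "d\<^sub>0 \<equiv> cf_min (e 0) (e (s - 1))"
  defines "d\<^sub>1 \<equiv> cf_max (e 0) (e (s - 1))"
  shows "(E = {d\<^sub>0..d\<^sub>1} \<longleftrightarrow> (\<forall>i\<in>{1..s - 1}. e i - e (i - 1) \<le> d\<^sub>1 - d\<^sub>0)) \<and>
    (E = {d\<^sub>0..d\<^sub>1} \<longrightarrow> e 0 * e (s - 1) \<le> (real s - 1)\<^sup>2 / real s)"
proof -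
  define n where "n = s - 1"
  have s: "{0..<s} = {..n}" "real s = real n + 1" and "0 < n"
    using \<open>s \<ge> 2\<close> by (auto simp: n_def)
  have mono: "mono_on {..n} e"
    using assms(3) unfolding s by (rule strict_mono_on_imp_mono_on)
  have "e 0 < e n"
    using strict_mono_onD[OF assms(3), of 0 n] \<open>0 < n\<close> unfolding s by simp
  have A: "A \<subseteq> {e 0..e n}"
    unfolding A_def s by (auto intro!: mono_onD[OF mono])
  have d: "d\<^sub>0 = cf_min (e 0) (e n)" "d\<^sub>1 = cf_max (e 0) (e n)"
    by (simp_all add: d\<^sub>0_def d\<^sub>1_def n_def)
  have "d\<^sub>0 \<le> d\<^sub>1"
    unfolding d using \<open>e 0 > 0\<close> \<open>e 0 < e n\<close> by (intro cf_min_max_fix) auto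
  have "E = {d\<^sub>0..d\<^sub>1} \<longleftrightarrow> (\<forall>y\<in>{e 0 + d\<^sub>0..e n + d\<^sub>1}. \<exists>a\<in>A. y - a \<in> {d\<^sub>0..d\<^sub>1})"
    unfolding E_def d by (rule cf_set_eq_interval_iff) (use A \<open>e 0 > 0\<close> \<open>e 0 < e n\<close> in auto)
  also have "\<dots> \<longleftrightarrow> (\<forall>y\<in>{e 0 + d\<^sub>0..e n + d\<^sub>1}. \<exists>i\<le>n. y - e i \<in> {d\<^sub>0..d\<^sub>1})"
    unfolding A_def s by (simp add: Bex_def)
  also have "\<dots> \<longleftrightarrow> (\<forall>i\<in>{1..n}. e i - e (i - 1) \<le> d\<^sub>1 - d\<^sub>0)"
    by (rule translates_cover_iff) fact+
  finally have iff: "E = {d\<^sub>0..d\<^sub>1} \<longleftrightarrow> (\<forall>i\<in>{1..n}. e i - e (i - 1) \<le> d\<^sub>1 - d\<^sub>0)" .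
  moreover have "e 0 * e n \<le> (real n)\<^sup>2 / (real n + 1)" if "E = {d\<^sub>0..d\<^sub>1}"
  proof (rule cf_diameter_bound)
    have "e n - e 0 = (\<Sum>i<n. e (Suc i) - e i)"
      by (simp add: sum_lessThan_telescope)
    also have "\<dots> \<le> (\<Sum>i<n. d\<^sub>1 - d\<^sub>0)"
    proof (rule sum_mono)
      fix i assume "i \<in> {..<n}"
      then have "Suc i \<in> {1..n}" by simp
      with that[unfolded iff] have "e (Suc i) - e (Suc i - 1) \<le> d\<^sub>1 - d\<^sub>0" by (rule bspec)
      then show "e (Suc i) - e i \<le> d\<^sub>1 - d\<^sub>0" by simp
    qed
    finally show "e n - e 0 \<le> real n * (cf_max (e 0) (e n) - cf_min (e 0) (e n))"
      by (simp add: d)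
  qed (use \<open>e 0 > 0\<close> \<open>e 0 < e n\<close> in auto)
  ultimately show ?thesis
    unfolding s(2) n_def[symmetric] by simp
qed

end
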